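(* Let $(M,\mathcal T)$ be a closed triangulated surface with inversive distance $I\ge0$ in hyperbolic background geometry. Then the space of all possible extended curvatures satisfies $$\widetilde K(\mathbb R^N_{>0})\subset\bigcap_{\emptyset\ne A\subsetneq V}\overline{Y_A},$$ where $\overline{Y_A}$ is the closure in $\mathbb R^N$ of $$Y_A=\Big\{x\in\mathbb R^N\ \Big|\ \sum_{i\in A}x_i>-\sum_{(e,v)\in Lk(A)}\big(\pi-\Lambda(I_e)\big)+2\pi\chi(F_A)\Big\}.$$
   Context: Setting. $M$ is a closed surface with a triangulation $\mathcal T=\{V,E,F\}$ (vertices, edges, faces), with vertices numbered $1,\dots,N$. The inversive distance is a fixed function $I:E\to[0,+\infty)$, with value $I_e$ or $I_{ij}$ on the edge $e=\{ij\}$. For $r=(r_1,\dots,r_N)\in\mathbb R^N_{>0}$, each edge $\{ij\}$ gets the hyperbolic length $l_{ij}=\cosh^{-1}(\cosh r_i\cosh r_j+I_{ij}\sinh r_i\sinh r_j)$. Extended curvature. For $r\in\mathbb R^N_{>0}$ and a face $\{ijk\}\in F$, the generalized inner angles are: if $l_{ij},l_{jk},l_{ik}$ satisfy the three strict triangle inequalities, $\tilde\theta_i^{jk}$ is the inner angle at vertex $i$ of the hyperbolic triangle with these edge lengths (and similarly at $j,k$); if one edge length is at least the sum of the other two, the generalized angle opposite to that edge is $\pi$ and the other two generalized angles are $0$. The extended curvature is $\widetilde K_i(r)=2\pi-\sum_{\{ijk\}\in F}\tilde\theta_i^{jk}$ (sum over faces containing $i$), and $\widetilde K=(\widetilde K_1,\dots,\widetilde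 K_N)$. Notation. $F_A$ is the subcomplex of $\mathcal T$ consisting of all simplices whose vertices all lie in $A$, and $\chi(F_A)$ is its Euler characteristic. $Lk(A)$ is the set of pairs $(e,v)$ of an edge $e$ and a vertex $v$ such that the end points of $e$ are not in $A$, $v\in A$, and $e$ and $v$ form a triangle of $F$. The function $\Lambda:\mathbb R\to[0,\pi]$ is $\Lambda(x)=\pi$ for $x\le-1$, $\Lambda(x)=\arccos x$ for $-1\le x\le1$, $\Lambda(x)=0$ for $x\ge1$. *)

theory Defs
  imports "HOL-Analysis.Analysis"
begin

section \<open>Closed triangulated surfaces\<close>

text \<open>Second countability is not listed because a compact locally Euclidean space has it.
  Connectedness is not required.\<close>

definition closed_surface :: "'m topology \<Rightarrow> bool" where
  "closed_surface M \<longleftrightarrow>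
     compact_space M \<and> Hausdorff_space M \<and>
     (\<forall>p\<in>topspace M. \<exists>U. openin M U \<and> p \<in> U \<and>
        (\<exists>W :: (real^2) set. open W \<and> subtopology M U homeomorphic_space top_of_set W))"

text \<open>The vertex set is the whole finite type \<open>'v\<close>, so that \<open>real^'v\<close> is the space of
  real functions on the vertices. Edges and faces are given by their sets of vertices.\<close>

definition simplices :: "'v set set \<Rightarrow> 'v set set \<Rightarrow> 'v set set" where
  "simplices E F = {{v} |v. True} \<union> E \<union> F"

definition simplicial_complex2 :: "'v set set \<Rightarrow> 'v set set \<Rightarrow> bool" where
  "simplicial_complex2 E F \<longleftrightarrow>
     (\<forall>e\<in>E. card e = 2) \<and> (\<forall>f\<in>F. card f = 3) \<and>
     (\<forall>f\<in>F. \<forall>e. e \<subseteq> f \<and> card e = 2 \<longrightarrow> e \<in> E)"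

definition geometric_realization :: "'v::finite set set \<Rightarrow> 'v set set \<Rightarrow> (real^'v) set" where
  "geometric_realization E F = (\<Union>\<sigma>\<in>simplices E F. convex hull ((\<lambda>v. axis v 1) ` \<sigma>))"

definition triangulates :: "'v::finite set set \<Rightarrow> 'v set set \<Rightarrow> 'm topology \<Rightarrow> bool" where
  "triangulates E F M \<longleftrightarrow>
     simplicial_complex2 E F \<and>
     top_of_set (geometric_realization E F) homeomorphic_space M"

definition subcomplex_on :: "'v set set \<Rightarrow> 'v set set \<Rightarrow> 'v set \<Rightarrow> 'v set set" where
  "subcomplex_on E F A = {\<sigma> \<in> simplices E F. \<sigma> \<subseteq> A}"

definition euler_char :: "'v set set \<Rightarrow> int" where
  "euler_char S = (\<Sum>\<sigma>\<in>S. (- 1) ^ (card \<sigma> - 1))"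

definition Lk :: "'v set set \<Rightarrow> 'v set set \<Rightarrow> 'v set \<Rightarrow> ('v set \<times> 'v) set" where
  "Lk E F A = {(e, v). e \<in> E \<and> e \<inter> A = {} \<and> v \<in> A \<and> insert v e \<in> F}"

section \<open>Angles of hyperbolic triangles\<close>

text \<open>The hyperbolic plane is the upper sheet of the hyperboloid in Minkowski space, with
  the Riemannian metric given by the Lorentz form on the tangent planes.\<close>

definition lorentz :: "real^3 \<Rightarrow> real^3 \<Rightarrow> real" where
  "lorentz x y = x$1 * y$1 + x$2 * y$2 - x$3 * y$3"

definition hyp_plane :: "(real^3) set" where
  "hyp_plane = {x. lorentz x x = - 1 \<and> x$3 > 0}"

definition hyp_dist :: "real^3 \<Rightarrow> real^3 \<Rightarrow> real" where
  "hyp_dist x y = arcosh (- lorentz x y)"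

text \<open>The projection of \<open>q\<close> to the tangent plane at \<open>p\<close>, a positive multiple of the initial
  velocity of the geodesic from \<open>p\<close> to \<open>q\<close>.\<close>

definition hyp_dir :: "real^3 \<Rightarrow> real^3 \<Rightarrow> real^3" where
  "hyp_dir p q = q + lorentz p q *\<^sub>R p"

definition hyp_angle :: "real^3 \<Rightarrow> real^3 \<Rightarrow> real^3 \<Rightarrow> real" where
  "hyp_angle p q s =
     arccos (lorentz (hyp_dir p q) (hyp_dir p s) /
       (sqrt (lorentz (hyp_dir p q) (hyp_dir p q)) * sqrt (lorentz (hyp_dir p s) (hyp_dir p s))))"

text \<open>The angle opposite to the edge of length \<open>a\<close> in the triangle with edge lengths
  \<open>a, b, c\<close>, which is unique up to isometry. Only meaningful if \<open>a, b, c\<close> satisfy the strict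
  triangle inequalities.\<close>

definition inner_angle :: "real \<Rightarrow> real \<Rightarrow> real \<Rightarrow> real" where
  "inner_angle a b c =
     (THE \<theta>. \<exists>p\<in>hyp_plane. \<exists>q\<in>hyp_plane. \<exists>s\<in>hyp_plane.
        hyp_dist q s = a \<and> hyp_dist p q = b \<and> hyp_dist p s = c \<and> \<theta> = hyp_angle p q s)"

definition gen_angle :: "real \<Rightarrow> real \<Rightarrow> real \<Rightarrow> real" where
  "gen_angle a b c =
     (if a < b + c \<and> b < a + c \<and> c < a + b then inner_angle a b c
      else if a \<ge> b + c then pi else 0)"

section \<open>Extended curvature\<close>

definition edge_length :: "('v set \<Rightarrow> real) \<Rightarrow> real^'v \<Rightarrow> 'v \<Rightarrow> 'v \<Rightarrow> real" where
  "edge_length I r i j = arcosh (cosh (r$i) * cosh (r$j) + I {i, j} * sinh (r$i) * sinh (r$j))"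

text \<open>The definite description is legitimate because the angle is symmetric in \<open>j\<close> and \<open>k\<close>.\<close>

definition face_angle :: "('v set \<Rightarrow> real) \<Rightarrow> real^'v \<Rightarrow> 'v set \<Rightarrow> 'v \<Rightarrow> real" where
  "face_angle I r f i =
     (THE \<theta>. \<exists>j k. f = {i, j, k} \<and> card f = 3 \<and>
        \<theta> = gen_angle (edge_length I r j k) (edge_length I r i j) (edge_length I r i k))"

definition ext_curvature :: "'v set set \<Rightarrow> ('v set \<Rightarrow> real) \<Rightarrow> real^'v \<Rightarrow> real^'v" where
  "ext_curvature F I r = (\<chi> i. 2 * pi - (\<Sum>f\<in>{f\<in>F. i \<in> f}. face_angle I r f i))"

definition Lam :: "real \<Rightarrow> real" where
  "Lam x = (if x \<le> - 1 then pi else if x \<le> 1 then arccos x else 0)"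

definition Y :: "'v set set \<Rightarrow> 'v set set \<Rightarrow> ('v set \<Rightarrow> real) \<Rightarrow> 'v set \<Rightarrow> (real^'v) set" where
  "Y E F I A = {x. (\<Sum>i\<in>A. x$i) >
     - (\<Sum>(e, v)\<in>Lk E F A. pi - Lam (I e)) + 2 * pi * of_int (euler_char (subcomplex_on E F A))}"

end

theory Submission
  imports Defs
begin

text \<open>Summing the curvatures over \<open>A\<close> gives \<open>2 * pi * card A\<close> minus all angles of faces
  at vertices of \<open>A\<close>. Group these angles by the number of vertices that the face has in \<open>A\<close>.

  A face with at least two vertices in \<open>A\<close> contributes at most \<open>pi\<close>, since the generalized
  angles of a face are nonnegative and sum to at most \<open>pi\<close> (lemma \<open>gen_angle_sum_le_pi\<close>). A face
  with exactly one vertex in \<open>A\<close> is an element \<open>(e, v)\<close> of the link, and its angle at \<open>v\<close> is at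
  most \<open>pi - Lam (I e)\<close> (lemma \<open>face_angle_bounds\<close>). By the law of cosines this angle bound only
  says that replacing the two radii at the ends of \<open>e\<close> by the lengths of the edges to \<open>v\<close>
  increases \<open>cosh x * cosh y + I e * sinh x * sinh y\<close>, and each of these edges is longer
  than the radius at either of its ends.

  It remains to see that \<open>pi\<close> times the number of faces with at least two vertices in \<open>A\<close> is at
  most \<open>2 * pi * (card A - euler_char)\<close>, where \<open>euler_char\<close> belongs to the full subcomplex
  on \<open>A\<close>. A face with two vertices in \<open>A\<close> has one edge there and a face with three has three, so
  this amounts to counting incidences of edges and faces: every edge lies on at most two faces.
  That is the only place where the topology of the surface enters, through invariance of domain
  (lemma \<open>edge_in_at_most_two_faces\<close>). The resulting inequality is not strict, which is why the
  conclusion is about the closure of the half-space.\<close>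

section \<open>The hyperbolic law of cosines\<close>

text \<open>The cosine of the angle opposite to \<open>a\<close> according to the hyperbolic law of cosines. It is
  considered for all positive \<open>a, b, c\<close>, and it leaves the open interval from \<open>- 1\<close> to \<open>1\<close>
  exactly when a strict triangle inequality fails.\<close>
definition cos_ratio :: "real \<Rightarrow> real \<Rightarrow> real \<Rightarrow> real" where
  "cos_ratio a b c = (cosh b * cosh c - cosh a) / (sinh b * sinh c)"

lemma cos_ratio_commute: "cos_ratio a b c = cos_ratio a c b"
  by (simp add: cos_ratio_def mult.commute)

text \<open>The reversed Cauchy-Schwarz inequality for future timelike unit vectors. It places
  \<open>- lorentz p q\<close> in the range where \<open>arcosh\<close> inverts \<open>cosh\<close>.\<close>

lemma lorentz_le_minus_one:
  assumes "p \<in> hyp_plane" "q \<in> hyp_plane"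
  shows "lorentz p q \<le> - 1"
proof -
  define s where "s = p$1 * q$1 + p$2 * q$2"
  have p: "(p$3)\<^sup>2 = 1 + (p$1)\<^sup>2 + (p$2)\<^sup>2" "p$3 > 0"
    and q: "(q$3)\<^sup>2 = 1 + (q$1)\<^sup>2 + (q$2)\<^sup>2" "q$3 > 0"
    using assms by (auto simp: hyp_plane_def lorentz_def power2_eq_square)
  have "(p$3 * q$3)\<^sup>2 - (1 + s)\<^sup>2
      = (p$1 - q$1)\<^sup>2 + (p$2 - q$2)\<^sup>2 + (p$1 * q$2 - p$2 * q$1)\<^sup>2"
    unfolding power_mult_distrib p q s_def by (simp add: power2_eq_square algebra_simps)
  then have "(1 + s)\<^sup>2 \<le> (p$3 * q$3)\<^sup>2"
    by (smt (verit) zero_le_power2)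
  then have "1 + s \<le> p$3 * q$3"
    by (rule power2_le_imp_le) (use p q in simp)
  then show ?thesis
    by (simp add: lorentz_def s_def)
qed

lemma cosh_hyp_dist:
  assumes "p \<in> hyp_plane" "q \<in> hyp_plane"
  shows "cosh (hyp_dist p q) = - lorentz p q" "hyp_dist p q \<ge> 0"
  using lorentz_le_minus_one[OF assms] by (auto simp: hyp_dist_def)

lemma lorentz_hyp_dir:
  assumes "p \<in> hyp_plane"
  shows "lorentz (hyp_dir p q) (hyp_dir p s) = lorentz q s + lorentz p q * lorentz p s"
proof -
  have p: "lorentz p p = - 1"
    using assms by (simp add: hyp_plane_def)
  have "lorentz (hyp_dir p q) (hyp_dir p s)
      = lorentz q s + lorentz p q * lorentz p s * (2 + lorentz p p)"
    by (simp add: lorentz_def hyp_dir_def algebra_simps)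
  then show ?thesis
    by (simp add: p)
qed

lemma hyp_law_of_cosines:
  assumes "p \<in> hyp_plane" "q \<in> hyp_plane" "s \<in> hyp_plane"
  shows "hyp_angle p q s = arccos (cos_ratio (hyp_dist q s) (hyp_dist p q) (hyp_dist p s))"
proof -
  have norm: "sqrt (lorentz (hyp_dir p x) (hyp_dir p x)) = sinh (hyp_dist p x)"
    if "x \<in> hyp_plane" for x
  proof -
    have "lorentz (hyp_dir p x) (hyp_dir p x) = (sinh (hyp_dist p x))\<^sup>2"
      using that unfolding lorentz_hyp_dir[OF assms(1)] sinh_square_eq cosh_hyp_dist[OF assms(1) that]
      by (simp add: hyp_plane_def power2_eq_square)
    then show ?thesis
      using cosh_hyp_dist[OF assms(1) that] by simp
  qed
  have inner: "lorentz (hyp_dir p q) (hyp_dir p s)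
      = cosh (hyp_dist p q) * cosh (hyp_dist p s) - cosh (hyp_dist q s)"
    using assms by (simp add: lorentz_hyp_dir cosh_hyp_dist)
  show ?thesis
    unfolding hyp_angle_def norm[OF assms(2)] norm[OF assms(3)] inner cos_ratio_def ..
qed

text \<open>Put \<open>p\<close> at the apex of the hyperboloid and \<open>q\<close>, \<open>s\<close> at distances \<open>b\<close>, \<open>c\<close> in two directions
  that enclose the angle with cosine \<open>cos_ratio a b c\<close>; the law of cosines then forces the third
  side.\<close>

lemma triangle_in_hyp_plane:
  assumes "a \<ge> 0" "b > 0" "c > 0" "\<bar>cos_ratio a b c\<bar> \<le> 1"
  obtains p q s where "p \<in> hyp_plane" "q \<in> hyp_plane" "s \<in> hyp_plane"
    "hyp_dist q s = a" "hyp_dist p q = b" "hyp_dist p s = c"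
proof -
  define x where "x = cos_ratio a b c"
  define y where "y = sqrt (1 - x\<^sup>2)"
  have "x\<^sup>2 \<le> 1"
    using assms(4) by (simp add: x_def abs_square_le_1)
  then have y: "y\<^sup>2 = 1 - x\<^sup>2"
    by (simp add: y_def)
  define p q s :: "real^3" where "p = vector [0, 0, 1]" and "q = vector [sinh b, 0, cosh b]"
    and "s = vector [sinh c * x, sinh c * y, cosh c]"
  have "(sinh c * x)\<^sup>2 + (sinh c * y)\<^sup>2 - (cosh c)\<^sup>2 = - 1"
    by (simp add: power_mult_distrib y cosh_square_eq algebra_simps)
  then have mem: "p \<in> hyp_plane" "q \<in> hyp_plane" "s \<in> hyp_plane"
    by (simp_all add: hyp_plane_def lorentz_def p_def q_def s_def vector_3 power2_eq_square
        hyperbolic_pythagoras[unfolded power2_eq_square, of b] algebra_simps)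
      (use hyperbolic_pythagoras[of b] in \<open>simp add: power2_eq_square\<close>)
  have "sinh b \<noteq> 0" "sinh c \<noteq> 0"
    using assms by auto
  then have "cosh b * cosh c - sinh b * (sinh c * x) = cosh a"
    by (simp add: x_def cos_ratio_def field_simps)
  then have "hyp_dist q s = a" "hyp_dist p q = b" "hyp_dist p s = c"
    using assms(1-3)
    by (simp_all add: hyp_dist_def lorentz_def p_def q_def s_def vector_3 arcosh_cosh_real)
  with mem show ?thesis
    using that by blast
qed

text \<open>Existence of a triangle makes the definite description meaningful, and the law of
  cosines makes its value the same for every such triangle.\<close>

lemma inner_angle_eq:
  assumes "a \<ge> 0" "b > 0" "c > 0" "\<bar>cos_ratio a b c\<bar> \<le> 1"
  shows "inner_angle a b c = arccos (cos_ratio a b c)"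
  unfolding inner_angle_def
proof (rule the_equality)
  obtain p q s where "p \<in> hyp_plane" "q \<in> hyp_plane" "s \<in> hyp_plane"
    "hyp_dist q s = a" "hyp_dist p q = b" "hyp_dist p s = c"
    using triangle_in_hyp_plane[OF assms] .
  then show "\<exists>p\<in>hyp_plane. \<exists>q\<in>hyp_plane. \<exists>s\<in>hyp_plane. hyp_dist q s = a \<and>
      hyp_dist p q = b \<and> hyp_dist p s = c \<and> arccos (cos_ratio a b c) = hyp_angle p q s"
    using hyp_law_of_cosines by metis
next
  fix \<theta>
  assume "\<exists>p\<in>hyp_plane. \<exists>q\<in>hyp_plane. \<exists>s\<in>hyp_plane. hyp_dist q s = a \<and>
      hyp_dist p q = b \<and> hyp_dist p s = c \<and> \<theta> = hyp_angle p q s"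
  then show "\<theta> = arccos (cos_ratio a b c)"
    using hyp_law_of_cosines by metis
qed

section \<open>Generalized angles\<close>

lemma cos_ratio_le_minus_one_iff:
  assumes "a > 0" "b > 0" "c > 0"
  shows "cos_ratio a b c \<le> - 1 \<longleftrightarrow> b + c \<le> a"
proof -
  have "sinh b * sinh c > 0"
    using assms by simp
  then have "cos_ratio a b c \<le> - 1 \<longleftrightarrow> cosh (b + c) \<le> cosh a"
    by (simp add: cos_ratio_def pos_divide_le_eq cosh_add) linarith
  then show ?thesis
    using assms by (simp add: cosh_real_nonneg_le_iff)
qed

lemma cos_ratio_ge_one_iff:
  assumes "a > 0" "b > 0" "c > 0"
  shows "cos_ratio a b c \<ge> 1 \<longleftrightarrow> a + c \<le> b \<or> a + b \<le> c"
proof -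
  have "sinh b * sinh c > 0"
    using assms by simp
  then have "cos_ratio a b c \<ge> 1 \<longleftrightarrow> cosh a \<le> cosh (b - c)"
    by (simp add: cos_ratio_def pos_le_divide_eq cosh_diff) linarith
  also have "cosh (b - c) = cosh \<bar>b - c\<bar>"
    by simp
  also have "cosh a \<le> \<dots> \<longleftrightarrow> a \<le> \<bar>b - c\<bar>"
    using assms by (subst cosh_real_nonneg_le_iff) auto
  finally show ?thesis
    using assms by linarith
qed

text \<open>The prescribed values \<open>pi\<close> and \<open>0\<close> for degenerate edge lengths are those that clamping the
  cosine to the interval from \<open>- 1\<close> to \<open>1\<close> would produce, so one formula covers all cases and
  comparing angles becomes comparing \<open>cos_ratio\<close>.\<close>

lemma gen_angle_eq_Lam:
  assumes "a > 0" "b > 0" "c > 0"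
  shows "gen_angle a b c = Lam (cos_ratio a b c)"
proof -
  note iffs = cos_ratio_le_minus_one_iff[OF assms] cos_ratio_ge_one_iff[OF assms]
  consider "a < b + c" "b < a + c" "c < a + b" | "b + c \<le> a" | "a < b + c" "a + c \<le> b \<or> a + b \<le> c"
    by linarith
  then show ?thesis
  proof cases
    case 1
    then have "\<not> cos_ratio a b c \<le> - 1" "\<not> cos_ratio a b c \<ge> 1"
      using iffs by auto
    then show ?thesis
      using 1 assms by (simp add: gen_angle_def Lam_def inner_angle_eq)
  next
    case 2
    then show ?thesis
      using iffs assms by (simp add: gen_angle_def Lam_def)
  next
    case 3
    then have "cos_ratio a b c \<ge> 1"
      using iffs by simp
    then have "Lam (cos_ratio a b c) = 0"
      by (cases "cos_ratio a b c = 1") (auto simp: Lam_def)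
    then show ?thesis
      using 3 assms by (auto simp: gen_angle_def)
  qed
qed

lemma Lam_bounds: "0 \<le> Lam x" "Lam x \<le> pi"
  by (auto simp: Lam_def arccos_lbound arccos_ubound)

lemma Lam_antimono: "x \<le> y \<Longrightarrow> Lam y \<le> Lam x"
  by (auto simp: Lam_def arccos_lbound arccos_ubound intro: arccos_le_arccos)

lemma Lam_minus: "Lam (- x) = pi - Lam x"
proof (cases "x = 1 \<or> x = -1")
  case True
  then show ?thesis by (auto simp: Lam_def)
qed (auto simp: Lam_def arccos_minus)

text \<open>The hypothesis on the cosines compares \<open>\<gamma>\<close> with \<open>\<bar>\<alpha> + \<beta> - pi\<bar>\<close>. It therefore does not exclude
  an angle sum above \<open>pi\<close> by itself, but restricts such a triple to \<open>\<gamma> \<le> \<alpha> + \<beta> - pi\<close>.\<close>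

lemma angle_le_if_cos_ge:
  fixes \<alpha> \<beta> \<gamma> :: real
  assumes "0 \<le> \<alpha>" "\<alpha> \<le> pi" "0 \<le> \<beta>" "\<beta> \<le> pi" "0 \<le> \<gamma>" "\<gamma> \<le> pi"
    and "cos \<gamma> \<ge> - cos (\<alpha> + \<beta>)" "\<alpha> + \<beta> + \<gamma> > pi"
  shows "\<gamma> \<le> \<alpha> + \<beta> - pi"
proof -
  have *: "cos \<gamma> \<ge> cos (\<alpha> + \<beta> - pi)"
    using assms(7) by (simp add: cos_diff)
  show ?thesis
  proof (cases "\<alpha> + \<beta> \<le> pi")
    case True
    then have "cos \<gamma> \<ge> cos (pi - (\<alpha> + \<beta>))"
      using * by (simp add: cos_diff)
    then have "\<gamma> \<le> pi - (\<alpha> + \<beta>)"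
      using True assms by (subst (asm) cos_mono_le_eq) auto
    then show ?thesis
      using assms by linarith
  next
    case False
    then show ?thesis
      using * assms by (subst (asm) cos_mono_le_eq) auto
  qed
qed

text \<open>The dual law of cosines says that the cosine of the third angle plus the product of the
  other two cosines is \<open>cosh c\<close> times the product of their sines; the claim is what remains after
  \<open>cosh c \<ge> 1\<close>.\<close>

lemma dual_law_of_cosines_ineq:
  fixes a b c :: real
  assumes pos: "a > 0" "b > 0" "c > 0"
    and "\<bar>cos_ratio a b c\<bar> \<le> 1" "\<bar>cos_ratio b a c\<bar> \<le> 1" "\<bar>cos_ratio c a b\<bar> \<le> 1"
  shows "cos_ratio c a b
    \<ge> - cos (arccos (cos_ratio a b c) + arccos (cos_ratio b a c))"
proof -
  define x y z where "x = cosh a" "y = cosh b" "z = cosh c"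
  define u v w where "u = sinh a" "v = sinh b" "w = sinh c"
  note defs = x_y_z_def u_v_w_def
  have uvw: "u > 0" "v > 0" "w > 0"
    using pos by (auto simp: defs)
  have sq: "u\<^sup>2 = x\<^sup>2 - 1" "v\<^sup>2 = y\<^sup>2 - 1" "w\<^sup>2 = z\<^sup>2 - 1"
    by (simp_all add: defs sinh_square_eq)
  have z: "z \<ge> 1"
    by (simp add: defs cosh_real_ge_1)
  \<comment> \<open>The Gram determinant of the triangle up to sign; its square root divided by two of the
    hyperbolic sines is the sine of the enclosed angle.\<close>
  define D where "D = 1 + 2 * x * y * z - x\<^sup>2 - y\<^sup>2 - z\<^sup>2"
  have A: "cos_ratio a b c = (y * z - x) / (v * w)"
    and B: "cos_ratio b a c = (x * z - y) / (u * w)"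
    and C: "cos_ratio c a b = (x * y - z) / (u * v)"
    by (simp_all add: cos_ratio_def defs)
  have "1 - (cos_ratio a b c)\<^sup>2 = ((v\<^sup>2 * w\<^sup>2) - (y * z - x)\<^sup>2) / (v * w)\<^sup>2"
    using uvw by (simp add: A power_divide power_mult_distrib field_simps)
  also have "v\<^sup>2 * w\<^sup>2 - (y * z - x)\<^sup>2 = D"
    unfolding sq D_def by (simp add: power2_eq_square algebra_simps)
  finally have sinA: "sin (arccos (cos_ratio a b c)) = sqrt D / (v * w)"
    using assms(4) uvw by (simp add: sin_arccos_abs real_sqrt_divide)
  have "1 - (cos_ratio b a c)\<^sup>2 = ((u\<^sup>2 * w\<^sup>2) - (x * z - y)\<^sup>2) / (u * w)\<^sup>2"
    using uvw by (simp add: B power_divide power_mult_distrib field_simps)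
  also have "u\<^sup>2 * w\<^sup>2 - (x * z - y)\<^sup>2 = D"
    unfolding sq D_def by (simp add: power2_eq_square algebra_simps)
  finally have sinB: "sin (arccos (cos_ratio b a c)) = sqrt D / (u * w)"
    using assms(5) uvw by (simp add: sin_arccos_abs real_sqrt_divide)
  have "0 \<le> 1 - (cos_ratio a b c)\<^sup>2"
    using assms(4) by (simp add: abs_square_le_1)
  then have D: "D \<ge> 0"
    using \<open>1 - (cos_ratio a b c)\<^sup>2 = _\<close> \<open>v\<^sup>2 * w\<^sup>2 - (y * z - x)\<^sup>2 = D\<close> uvw
    by (simp add: zero_le_divide_iff)
  have "cos_ratio c a b + cos_ratio a b c * cos_ratio b a c
      = ((x * y - z) * w\<^sup>2 + (y * z - x) * (x * z - y)) / (u * v * w\<^sup>2)"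
    unfolding A B C using uvw by (simp add: field_simps power2_eq_square)
  also have "(x * y - z) * w\<^sup>2 + (y * z - x) * (x * z - y) = z * D"
    unfolding sq D_def by (simp add: power2_eq_square algebra_simps)
  finally have "cos_ratio c a b + cos_ratio a b c * cos_ratio b a c = z * (D / (u * v * w\<^sup>2))"
    by simp
  also have "\<dots> \<ge> 1 * (D / (u * v * w\<^sup>2))"
    using z D uvw by (intro mult_right_mono) auto
  finally have "cos_ratio c a b + cos_ratio a b c * cos_ratio b a c \<ge> D / (u * v * w\<^sup>2)"
    by simp
  also have "D / (u * v * w\<^sup>2) = sin (arccos (cos_ratio a b c)) * sin (arccos (cos_ratio b a c))"
    unfolding sinA sinB using D by (simp add: power2_eq_square)
  finally show ?thesis
    using assms(4,5) by (simp add: cos_add cos_arccos_abs)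
qed

text \<open>In the nondegenerate case, if the sum exceeded \<open>pi\<close>, then the dual law of cosines would give
  both \<open>\<gamma> \<le> \<alpha> + \<beta> - pi\<close> and \<open>\<beta> \<le> \<alpha> + \<gamma> - pi\<close>. Adding these gives \<open>\<alpha> \<ge> pi\<close>, which contradicts
  the strict triangle inequality for \<open>a\<close>. In the degenerate case one angle is \<open>pi\<close> and the other
  two vanish.\<close>

lemma gen_angle_sum_le_pi:
  assumes pos: "a > 0" "b > 0" "c > 0"
  shows "gen_angle a b c + gen_angle b a c + gen_angle c a b \<le> pi"
proof (cases "a < b + c \<and> b < a + c \<and> c < a + b")
  case False
  then show ?thesis
    using pos by (auto simp: gen_angle_def)
next
  case True
  define \<alpha> \<beta> \<gamma> where "\<alpha> = arccos (cos_ratio a b c)" "\<beta> = arccos (cos_ratio b a c)"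
    "\<gamma> = arccos (cos_ratio c a b)"
  note defs = \<alpha>_\<beta>_\<gamma>_def
  have "\<not> cos_ratio a b c \<le> - 1" "\<not> cos_ratio a b c \<ge> 1" "\<not> cos_ratio b a c \<le> - 1"
    "\<not> cos_ratio b a c \<ge> 1" "\<not> cos_ratio c a b \<le> - 1" "\<not> cos_ratio c a b \<ge> 1"
    using True pos by (auto simp: cos_ratio_le_minus_one_iff cos_ratio_ge_one_iff)
  then have abs: "\<bar>cos_ratio a b c\<bar> < 1" "\<bar>cos_ratio b a c\<bar> < 1" "\<bar>cos_ratio c a b\<bar> < 1"
    by auto
  have bd: "0 \<le> \<alpha>" "\<alpha> \<le> pi" "0 \<le> \<beta>" "\<beta> \<le> pi" "0 \<le> \<gamma>" "\<gamma> \<le> pi"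
    using abs by (auto simp: defs arccos_lbound arccos_ubound)
  have cosABC: "cos \<alpha> = cos_ratio a b c" "cos \<beta> = cos_ratio b a c" "cos \<gamma> = cos_ratio c a b"
    using abs by (auto simp: defs cos_arccos_abs)
  have "\<alpha> + \<beta> + \<gamma> \<le> pi"
  proof (rule ccontr)
    assume "\<not> ?thesis"
    then have sum: "\<alpha> + \<beta> + \<gamma> > pi" "\<alpha> + \<gamma> + \<beta> > pi"
      by auto
    have "\<gamma> \<le> \<alpha> + \<beta> - pi"
      using dual_law_of_cosines_ineq[of a b c] pos abs
      by (intro angle_le_if_cos_ge bd sum) (auto simp: cosABC(3) defs)
    moreover have "\<beta> \<le> \<alpha> + \<gamma> - pi"
      using dual_law_of_cosines_ineq[of a c b] pos abs
      by (intro angle_le_if_cos_ge bd sum)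
        (auto simp: cosABC(2) defs cos_ratio_commute[of _ c b]
          cos_ratio_commute[of _ c a] cos_ratio_commute[of _ b a])
    ultimately have "\<alpha> = pi"
      using bd by linarith
    then show False
      using cosABC(1) abs by simp
  qed
  then show ?thesis
    using pos abs by (simp add: gen_angle_eq_Lam Lam_def defs abs_less_iff)
qed

section \<open>Angles of a face\<close>

lemma edge_length_commute: "edge_length I r i j = edge_length I r j i"
  by (simp add: edge_length_def insert_commute mult_ac)

lemma edge_length_bounds:
  assumes "r$i > 0" "r$j > 0" "0 \<le> I {i, j}"
  shows "cosh (edge_length I r i j) = cosh (r$i) * cosh (r$j) + I {i, j} * sinh (r$i) * sinh (r$j)"
    and "r$i < edge_length I r i j"
proof -
  let ?X = "cosh (r$i) * cosh (r$j) + I {i, j} * sinh (r$i) * sinh (r$j)"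
  have "cosh (r$j) > 1"
    using cosh_real_nonneg_less_iff[of 0 "r$j"] assms by simp
  then have "cosh (r$i) * 1 < cosh (r$i) * cosh (r$j)"
    by (intro mult_strict_left_mono) auto
  also have "\<dots> \<le> ?X"
    using assms by simp
  finally have less: "cosh (r$i) < ?X"
    by simp
  then have X: "?X \<ge> 1"
    using cosh_real_ge_1[of "r$i"] by linarith
  then show eq: "cosh (edge_length I r i j) = ?X"
    by (simp add: edge_length_def)
  have "edge_length I r i j \<ge> 0"
    using X by (simp add: edge_length_def)
  then show "r$i < edge_length I r i j"
    using less assms by (subst cosh_real_nonneg_less_iff[symmetric]) (auto simp: eq)
qed

lemma gen_angle_adjacent_commute:
  assumes "a > 0" "b > 0" "c > 0"
  shows "gen_angle a b c = gen_angle a c b"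
  using assms by (simp add: gen_angle_eq_Lam cos_ratio_commute)

lemma face_angle_eq:
  assumes r: "\<forall>i. 0 < r$i" and ne: "i \<noteq> j" "i \<noteq> k" "j \<noteq> k"
    and I: "0 \<le> I {i, j}" "0 \<le> I {i, k}" "0 \<le> I {j, k}"
  shows "face_angle I r {i, j, k} i
    = gen_angle (edge_length I r j k) (edge_length I r i j) (edge_length I r i k)"
proof -
  have pos: "edge_length I r i j > 0" "edge_length I r i k > 0" "edge_length I r j k > 0"
    using r I edge_length_bounds(2) by (meson order.strict_trans)+
  show ?thesis
    unfolding face_angle_def
  proof (rule the_equality)
    show "\<exists>j' k'. {i, j, k} = {i, j', k'} \<and> card {i, j, k} = 3 \<and>
        gen_angle (edge_length I r j k) (edge_length I r i j) (edge_length I r i k)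
        = gen_angle (edge_length I r j' k') (edge_length I r i j') (edge_length I r i k')"
      using ne by (intro exI[of _ j] exI[of _ k]) auto
  next
    fix \<theta>
    assume "\<exists>j' k'. {i, j, k} = {i, j', k'} \<and> card {i, j, k} = 3 \<and>
      \<theta> = gen_angle (edge_length I r j' k') (edge_length I r i j') (edge_length I r i k')"
    then obtain j' k' where jk: "{i, j, k} = {i, j', k'}"
      and \<theta>: "\<theta> = gen_angle (edge_length I r j' k') (edge_length I r i j') (edge_length I r i k')"
      by blast
    have "j' = j \<and> k' = k \<or> j' = k \<and> k' = j"
      using jk ne by (auto simp: set_eq_iff; metis)
    then show "\<theta> = gen_angle (edge_length I r j k) (edge_length I r i j) (edge_length I r i k)"
      using \<theta> gen_angle_adjacent_commute[OF pos(3,1,2)] edge_length_commute[of I r] by auto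
  qed
qed

text \<open>The second bound is the one that involves the inversive distance. By the law of cosines it
  reads \<open>cosh a \<le> cosh b * cosh c + I {j, k} * sinh b * sinh c\<close> for the edge lengths \<open>a, b, c\<close>
  opposite to \<open>i, k, j\<close>. The left side is the same expression at the radii of \<open>j\<close> and \<open>k\<close>, which
  are smaller than \<open>b\<close> and \<open>c\<close>, and the expression is increasing because \<open>I {j, k} \<ge> 0\<close>.\<close>

lemma face_angle_bounds:
  assumes r: "\<forall>i. 0 < r$i" and ne: "i \<noteq> j" "i \<noteq> k" "j \<noteq> k"
    and I: "0 \<le> I {i, j}" "0 \<le> I {i, k}" "0 \<le> I {j, k}"
  shows "0 \<le> face_angle I r {i, j, k} i"
    and "face_angle I r {i, j, k} i \<le> pi - Lam (I {j, k})"
    and "face_angle I r {i, j, k} i + face_angle I r {i, j, k} j + face_angle I r {i, j, k} k \<le> pi"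
proof -
  let ?a = "edge_length I r j k" and ?b = "edge_length I r i j" and ?c = "edge_length I r i k"
  have pos: "?a > 0" "?b > 0" "?c > 0"
    using r I edge_length_bounds(2) by (meson order.strict_trans)+
  have i: "face_angle I r {i, j, k} i = gen_angle ?a ?b ?c"
    by (rule face_angle_eq) (use assms in auto)
  have "face_angle I r {j, i, k} j = gen_angle ?c (edge_length I r j i) ?a"
    by (rule face_angle_eq) (use assms in \<open>auto simp: insert_commute\<close>)
  then have j: "face_angle I r {i, j, k} j = gen_angle ?c ?a ?b"
    using gen_angle_adjacent_commute[OF pos(3,2,1)]
    by (simp add: insert_commute edge_length_commute[of I r j i])
  have "face_angle I r {k, i, j} k = gen_angle ?b (edge_length I r k i) (edge_length I r k j)"
    by (rule face_angle_eq) (use assms in \<open>auto simp: insert_commute\<close>)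
  moreover have "{k, i, j} = {i, j, k}" by auto
  ultimately have k: "face_angle I r {i, j, k} k = gen_angle ?b ?a ?c"
    using gen_angle_adjacent_commute[OF pos(2,3,1)] 
    by (simp add: edge_length_commute[of I r k])
  show "0 \<le> face_angle I r {i, j, k} i"
    by (simp add: i gen_angle_eq_Lam pos Lam_bounds)
  show "face_angle I r {i, j, k} i + face_angle I r {i, j, k} j + face_angle I r {i, j, k} k \<le> pi"
    using gen_angle_sum_le_pi[OF pos] by (simp add: i j k)
  have le: "r$j \<le> ?b" "r$k \<le> ?c"
    using edge_length_bounds(2)[of r j i I] edge_length_bounds(2)[of r k i I] r I
    by (auto simp: insert_commute edge_length_commute[of I r i] intro: less_imp_le)
  have rjk: "r$j > 0" "r$k > 0"
    using r by auto
  have "cosh ?a = cosh (r$j) * cosh (r$k) + I {j, k} * sinh (r$j) * sinh (r$k)"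
    using r I by (intro edge_length_bounds) auto
  also have "\<dots> \<le> cosh ?b * cosh ?c + I {j, k} * sinh ?b * sinh ?c"
    using le rjk I by (intro add_mono mult_mono) (auto simp: cosh_real_nonneg_le_iff)
  finally have "- I {j, k} \<le> cos_ratio ?a ?b ?c"
    using pos by (simp add: cos_ratio_def pos_le_divide_eq)
  then have "Lam (cos_ratio ?a ?b ?c) \<le> Lam (- I {j, k})"
    by (rule Lam_antimono)
  then show "face_angle I r {i, j, k} i \<le> pi - Lam (I {j, k})"
    by (simp add: i gen_angle_eq_Lam pos Lam_minus)
qed

section \<open>An edge of a triangulated surface\<close>

text \<open>The charts of the surface, transported to the realization. Only an injective continuous
  map into the plane is kept, which is all that invariance of domain asks for.\<close>

lemma triangulated_surface_locally_planar:
  fixes E F :: "'v::finite set set"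
  assumes M: "closed_surface M" and T: "triangulates E F M"
    and p: "p \<in> geometric_realization E F"
  obtains V and k :: "real^'v \<Rightarrow> real^2"
  where "openin (top_of_set (geometric_realization E F)) V" "p \<in> V"
    "continuous_on V k" "inj_on k V"
proof -
  let ?G = "geometric_realization E F"
  obtain h h' where h: "homeomorphic_maps (top_of_set ?G) M h h'"
    using T by (auto simp: triangulates_def homeomorphic_space_def)
  then have ch: "continuous_map (top_of_set ?G) M h" and hinv: "\<And>x. x \<in> ?G \<Longrightarrow> h' (h x) = x"
    by (auto simp: homeomorphic_maps_def)
  have "h p \<in> topspace M"
    using ch p by (auto simp: continuous_map_def)
  then obtain U and W :: "(real^2) set" where U: "openin M U" "h p \<in> U"
    and "subtopology M U homeomorphic_space top_of_set W"
    using M unfolding closed_surface_def by blast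
  then obtain g g' where g: "homeomorphic_maps (subtopology M U) (top_of_set W) g g'"
    by (auto simp: homeomorphic_space_def)
  have UM: "U \<subseteq> topspace M"
    using U(1) by (rule openin_subset)
  have cg: "continuous_map (subtopology M U) (top_of_set W) g" and ginv: "\<And>x. x \<in> U \<Longrightarrow> g' (g x) = x"
    using g UM by (auto simp: homeomorphic_maps_def)
  define V where "V = {x \<in> ?G. h x \<in> U}"
  have "openin (top_of_set ?G) V"
    using openin_continuous_map_preimage[OF ch U(1)] by (simp add: V_def)
  moreover have "p \<in> V"
    using p U by (simp add: V_def)
  moreover have "continuous_on V (g \<circ> h)"
  proof -
    have "continuous_map (top_of_set V) M h"
      using continuous_map_from_subtopology[OF ch, of V]
      by (simp add: subtopology_subtopology V_def Int_def conj_ac)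
    then have "continuous_map (top_of_set V) (subtopology M U) h"
      by (auto simp: continuous_map_in_subtopology V_def)
    then have "continuous_map (top_of_set V) (top_of_set W) (g \<circ> h)"
      using cg by (rule continuous_map_compose)
    then show ?thesis
      by (simp add: continuous_map_in_subtopology)
  qed
  moreover have "inj_on (g \<circ> h) V"
  proof (rule inj_onI)
    fix x y assume "x \<in> V" "y \<in> V" "(g \<circ> h) x = (g \<circ> h) y"
    then have "h x = h y"
      using ginv by (metis (no_types, lifting) V_def comp_apply mem_Collect_eq)
    then show "x = y"
      using hinv \<open>x \<in> V\<close> \<open>y \<in> V\<close> by (metis (no_types, lifting) V_def mem_Collect_eq)
  qed
  ultimately show ?thesis
    by (rule that)
qed

lemma triangle_point_in_realization:
  fixes E F :: "'v::finite set set"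
  assumes "{a, b, c} \<in> F" "0 \<le> s" "0 \<le> t" "0 \<le> u" "s + t + u = 1"
  shows "s *\<^sub>R axis a 1 + t *\<^sub>R axis b 1 + u *\<^sub>R axis c 1 \<in> geometric_realization E F"
proof -
  have "s *\<^sub>R axis a 1 + t *\<^sub>R axis b 1 + u *\<^sub>R axis c 1
      \<in> convex hull ((\<lambda>v. axis v 1) ` {a, b, c} :: (real^'v) set)"
    unfolding image_insert image_empty convex_hull_3
    by (intro CollectI exI[of _ s] exI[of _ t] exI[of _ u] conjI refl assms(2-))
  then show ?thesis
    unfolding geometric_realization_def
    by (rule UN_I[rotated]) (simp add: simplices_def assms(1))
qed

text \<open>Two triangles \<open>{a, b, c}\<close> and \<open>{a, b, d}\<close> form a disk around the midpoint \<open>p\<close> of their common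
  edge. By invariance of domain, a chart at \<open>p\<close> maps a small piece of this disk onto an open set of
  the plane. In a third triangle \<open>{a, b, x}\<close> points outside the disk converge to \<open>p\<close>, so their
  images eventually lie in that open set, which contradicts injectivity of the chart.\<close>

lemma edge_in_at_most_two_faces:
  fixes E F :: "'v::finite set set"
  assumes M: "closed_surface M" and T: "triangulates E F M" and e: "card e = 2"
  shows "card {f \<in> F. e \<subseteq> f} \<le> 2"
proof (rule ccontr)
  let ?G = "geometric_realization E F"
  obtain a b where ab: "e = {a, b}" "a \<noteq> b"
    using e by (auto simp: card_2_iff)
  assume "\<not> ?thesis"
  then have "3 \<le> card {f \<in> F. e \<subseteq> f}" by simp
  then obtain S where S: "S \<subseteq> {f \<in> F. e \<subseteq> f}" "card S = 3"
    by (meson obtain_subset_with_card_n)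
  then obtain f1 f2 f3 where S_eq: "S = {f1, f2, f3}" and dist: "f1 \<noteq> f2" "f1 \<noteq> f3" "f2 \<noteq> f3"
    unfolding card_3_iff by metis
  have f: "f1 \<in> F" "f2 \<in> F" "f3 \<in> F" "e \<subseteq> f1" "e \<subseteq> f2" "e \<subseteq> f3"
    using S(1) unfolding S_eq by blast+
  have third: "\<exists>c. f = {a, b, c} \<and> c \<noteq> a \<and> c \<noteq> b" if "f \<in> F" "e \<subseteq> f" for f
  proof -
    have "card f = 3"
      using T that by (auto simp: triangulates_def simplicial_complex2_def)
    then have "card (f - e) = 1"
      using that e by (subst card_Diff_subset) auto
    then obtain c where "f - e = {c}"
      by (auto simp: card_1_singleton_iff)
    then show ?thesis
      using that ab by (intro exI[of _ c]) auto
  qed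
  obtain c d x where f_eq: "f1 = {a, b, c}" "f2 = {a, b, d}" "f3 = {a, b, x}"
    and ne: "c \<noteq> a" "c \<noteq> b" "d \<noteq> a" "d \<noteq> b" "x \<noteq> a" "x \<noteq> b"
    using third[OF f(1,4)] third[OF f(2,5)] third[OF f(3,6)] by blast
  have ne': "c \<noteq> d" "c \<noteq> x" "d \<noteq> x"
    using dist f_eq by blast+
  define p :: "real^'v" where "p = (1/2) *\<^sub>R axis a 1 + (1/2) *\<^sub>R axis b 1"
  have "p \<in> ?G"
    using triangle_point_in_realization[of a b c F "1/2" "1/2" 0] f f_eq by (simp add: p_def)
  then obtain V and k :: "real^'v \<Rightarrow> real^2" where V: "openin (top_of_set ?G) V" "p \<in> V"
    and k: "continuous_on V k" "inj_on k V"
    using triangulated_surface_locally_planar[OF M T] by metis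
  \<comment> \<open>The disk: the first coordinate moves along the edge, the second moves into the triangle of
    \<open>c\<close> if positive and into that of \<open>d\<close> if negative.\<close>
  define \<phi> :: "real^2 \<Rightarrow> real^'v" where "\<phi> z = (1/2 + z$1 - \<bar>z$2\<bar>/2) *\<^sub>R axis a 1
    + (1/2 - z$1 - \<bar>z$2\<bar>/2) *\<^sub>R axis b 1 + max (z$2) 0 *\<^sub>R axis c 1 + max (- z$2) 0 *\<^sub>R axis d 1" for z
  have cont_\<phi>: "continuous_on X \<phi>" for X
    unfolding \<phi>_def by (intro continuous_intros; simp)
  \<comment> \<open>On this ball the barycentric weights of \<open>a\<close> and \<open>b\<close> are nonnegative.\<close>
  have \<phi>_G: "\<phi> z \<in> ?G" if "z \<in> ball 0 (1/4)" for z
  proof -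
    have "\<bar>z$1\<bar> < 1/4" "\<bar>z$2\<bar> < 1/4"
      using that component_le_norm_cart[of z 1] component_le_norm_cart[of z 2] by auto
    then show ?thesis
      using triangle_point_in_realization[of a b c F "1/2 + z$1 - \<bar>z$2\<bar>/2" "1/2 - z$1 - \<bar>z$2\<bar>/2" "\<bar>z$2\<bar>" E]
        triangle_point_in_realization[of a b d F "1/2 + z$1 - \<bar>z$2\<bar>/2" "1/2 - z$1 - \<bar>z$2\<bar>/2" "\<bar>z$2\<bar>" E] f f_eq
      by (cases "z$2 \<ge> 0") (auto simp: \<phi>_def max_def)
  qed
  have \<phi>_a: "\<phi> z $ a = 1/2 + z$1 - \<bar>z$2\<bar>/2" and \<phi>_c: "\<phi> z $ c = max (z$2) 0"
    and \<phi>_d: "\<phi> z $ d = max (- z$2) 0" and \<phi>_x: "\<phi> z $ x = 0" for z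
    using ne ne' ab by (auto simp: \<phi>_def axis_def)
  have inj_\<phi>: "inj \<phi>"
  proof (rule injI)
    fix z w assume eq: "\<phi> z = \<phi> w"
    have "z$2 = w$2"
      using \<phi>_c[of z] \<phi>_c[of w] \<phi>_d[of z] \<phi>_d[of w] eq by (auto simp: max_def split: if_splits)
    moreover have "z$1 = w$1"
      using \<phi>_a[of z] \<phi>_a[of w] eq calculation by simp
    ultimately show "z = w"
      by (simp add: vec_eq_iff forall_2)
  qed
  obtain V' where V': "open V'" "V = ?G \<inter> V'"
    using V(1) by (auto simp: openin_open)
  define B where "B = ball 0 (1/4) \<inter> \<phi> -` V'"
  have "open B"
    unfolding B_def using V'(1) cont_\<phi>[of UNIV] by (intro open_Int open_ball open_vimage) auto
  have \<phi>_B: "\<phi> ` B \<subseteq> V"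
    using \<phi>_G V' by (auto simp: B_def)
  have "0 \<in> B"
    using V V' by (auto simp: B_def \<phi>_def p_def)
  have "continuous_on B (k \<circ> \<phi>)"
    by (intro continuous_on_compose cont_\<phi> continuous_on_subset[OF k(1) \<phi>_B])
  moreover have "inj_on (k \<circ> \<phi>) B"
    using inj_\<phi> k(2) \<phi>_B by (intro comp_inj_on) (auto intro: inj_on_subset)
  ultimately have opn: "open ((k \<circ> \<phi>) ` B)"
    using \<open>open B\<close> by (intro invariance_of_domain)
  \<comment> \<open>The segment from the midpoint of the edge to the vertex \<open>x\<close> of the third triangle.\<close>
  define \<gamma> :: "real \<Rightarrow> real^'v" where
    "\<gamma> u = (1/2 - u/2) *\<^sub>R axis a 1 + (1/2 - u/2) *\<^sub>R axis b 1 + u *\<^sub>R axis x 1" for u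
  have \<gamma>_G: "\<gamma> u \<in> ?G" if "u \<in> {0..1}" for u
    using triangle_point_in_realization[of a b x F "1/2 - u/2" "1/2 - u/2" u E] f f_eq that by (simp add: \<gamma>_def)
  have \<gamma>0: "\<gamma> 0 = p"
    by (simp add: \<gamma>_def p_def)
  have "isCont \<gamma> 0"
    unfolding \<gamma>_def by (intro continuous_intros; simp)
  then have lim: "(\<gamma> \<longlongrightarrow> p) (at_right 0)"
    by (simp add: isCont_def \<gamma>0 filterlim_at_split)
  have "p \<in> V'"
    using V V' by simp
  with lim V'(1) have "eventually (\<lambda>u. \<gamma> u \<in> V') (at_right 0)"
    by (metis topological_tendstoD)
  moreover have "eventually (\<lambda>u::real. u \<in> {0<..<1}) (at_right 0)"
    by (rule eventually_at_right_real) simp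
  ultimately have ev: "eventually (\<lambda>u. 0 < u \<and> \<gamma> u \<in> V) (at_right 0)"
    by eventually_elim (use \<gamma>_G V' in auto)
  have "((\<lambda>u. k (\<gamma> u)) \<longlongrightarrow> k p) (at_right 0)"
    using k(1) lim V(2) by (rule continuous_on_tendsto_compose) (use ev in \<open>auto elim: eventually_mono\<close>)
  moreover have "k p \<in> (k \<circ> \<phi>) ` B"
    using \<open>0 \<in> B\<close> by (intro image_eqI[of _ _ 0]) (simp_all add: \<phi>_def p_def)
  ultimately have "eventually (\<lambda>u. k (\<gamma> u) \<in> (k \<circ> \<phi>) ` B) (at_right 0)"
    using opn by (metis topological_tendstoD)
  with ev have "eventually (\<lambda>u. 0 < u \<and> \<gamma> u \<in> V \<and> k (\<gamma> u) \<in> (k \<circ> \<phi>) ` B) (at_right 0)"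
    by eventually_elim auto
  then obtain u where u: "0 < u" "\<gamma> u \<in> V" "k (\<gamma> u) \<in> (k \<circ> \<phi>) ` B"
    using eventually_happens trivial_limit_at_right_real by blast
  then obtain z where "z \<in> B" "k (\<gamma> u) = k (\<phi> z)"
    by auto
  then have "\<gamma> u = \<phi> z"
    using k(2) u(2) \<phi>_B by (meson image_subset_iff inj_onD)
  moreover have "\<gamma> u $ x = u"
    using ne by (simp add: \<gamma>_def axis_def)
  ultimately show False
    using \<phi>_x[of z] u(1) by simp
qed

section \<open>Counting the faces that meet a set of vertices\<close>

text \<open>Increasing a single coordinate in \<open>A\<close> by an arbitrarily small amount makes the inequality
  strict; this is where nonemptiness of \<open>A\<close> matters.\<close>

lemma in_closure_Y:
  fixes x :: "real^'v::finite"
  assumes A: "A \<noteq> {}"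
    and ge: "(\<Sum>i\<in>A. x$i) \<ge> - (\<Sum>(e, v)\<in>Lk E F A. pi - Lam (I e))
      + 2 * pi * of_int (euler_char (subcomplex_on E F A))"
  shows "x \<in> closure (Y E F I A)"
  unfolding closure_approachable
proof (intro allI impI)
  fix \<epsilon> :: real assume "\<epsilon> > 0"
  obtain a where a: "a \<in> A"
    using A by blast
  let ?y = "x + (\<epsilon>/2) *\<^sub>R axis a 1"
  have "(\<Sum>i\<in>A. ?y$i) = (\<Sum>i\<in>A. x$i) + (\<Sum>i\<in>A. if i = a then \<epsilon>/2 else 0)"
    unfolding sum.distrib[symmetric] by (intro sum.cong) (auto simp: axis_def)
  also have "(\<Sum>i\<in>A. if i = a then \<epsilon>/2 else 0) = \<epsilon>/2"
    using a by simp
  finally have "?y \<in> Y E F I A"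
    using ge \<open>\<epsilon> > 0\<close> by (simp add: Y_def)
  moreover have "dist ?y x < \<epsilon>"
    using \<open>\<epsilon> > 0\<close> by (simp add: dist_norm)
  ultimately show "\<exists>y\<in>Y E F I A. dist y x < \<epsilon>"
    by blast
qed

lemma euler_char_subcomplex_on:
  fixes E F :: "'v::finite set set"
  assumes "simplicial_complex2 E F"
  shows "euler_char (subcomplex_on E F A)
    = int (card A) - int (card {e \<in> E. e \<subseteq> A}) + int (card {f \<in> F. f \<subseteq> A})"
proof -
  have E: "card e = 2" if "e \<in> E" for e
    using assms that by (auto simp: simplicial_complex2_def)
  have F: "card f = 3" if "f \<in> F" for f
    using assms that by (auto simp: simplicial_complex2_def)
  have "subcomplex_on E F A = (\<lambda>v. {v}) ` A \<union> {e \<in> E. e \<subseteq> A} \<union> {f \<in> F. f \<subseteq> A}"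
    by (auto simp: subcomplex_on_def simplices_def)
  moreover have "(\<lambda>v. {v}) ` A \<inter> {e \<in> E. e \<subseteq> A} = {}"
    "((\<lambda>v. {v}) ` A \<union> {e \<in> E. e \<subseteq> A}) \<inter> {f \<in> F. f \<subseteq> A} = {}"
    using E F by fastforce+
  ultimately have "euler_char (subcomplex_on E F A)
    = (\<Sum>\<sigma>\<in>(\<lambda>v. {v}) ` A. (- 1) ^ (card \<sigma> - 1)) + (\<Sum>\<sigma>\<in>{e \<in> E. e \<subseteq> A}. (- 1) ^ (card \<sigma> - 1))
      + (\<Sum>\<sigma>\<in>{f \<in> F. f \<subseteq> A}. (- 1) ^ (card \<sigma> - 1))"
    by (simp add: euler_char_def sum.union_disjoint)
  also have "(\<Sum>\<sigma>\<in>(\<lambda>v. {v}) ` A. (- 1) ^ (card \<sigma> - 1)) = int (card A)"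
    by (simp add: sum.reindex)
  also have "(\<Sum>\<sigma>\<in>{e \<in> E. e \<subseteq> A}. (- 1) ^ (card \<sigma> - 1)) = - int (card {e \<in> E. e \<subseteq> A})"
    using E by (simp add: sum_negf)
  also have "(\<Sum>\<sigma>\<in>{f \<in> F. f \<subseteq> A}. (- 1) ^ (card \<sigma> - 1)) = int (card {f \<in> F. f \<subseteq> A})"
    using F by simp
  finally show ?thesis
    by simp
qed

text \<open>The left side counts the pairs of a face and an edge of it with both ends in \<open>A\<close>. Counting
  the pairs by edges instead uses the bound on the faces at an edge.\<close>

lemma sum_choose_two_le:
  fixes E F :: "'v::finite set set"
  assumes sc: "simplicial_complex2 E F" and two: "\<And>e. e \<in> E \<Longrightarrow> card {f \<in> F. e \<subseteq> f} \<le> 2"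
  shows "(\<Sum>f\<in>F. card (A \<inter> f) choose 2) \<le> 2 * card {e \<in> E. e \<subseteq> A}"
proof -
  let ?EA = "{e \<in> E. e \<subseteq> A}"
  have "card (A \<inter> f) choose 2 = card {e \<in> ?EA. e \<subseteq> f}" if "f \<in> F" for f
  proof -
    have "{e \<in> ?EA. e \<subseteq> f} = {e. e \<subseteq> A \<inter> f \<and> card e = 2}"
      using sc that by (auto simp: simplicial_complex2_def)
    then show ?thesis
      using n_subsets[of "A \<inter> f" 2] by simp
  qed
  then have "(\<Sum>f\<in>F. card (A \<inter> f) choose 2) = (\<Sum>f\<in>F. card {e \<in> ?EA. e \<subseteq> f})"
    by (intro sum.cong) auto
  also have "\<dots> = (\<Sum>e\<in>?EA. card {f \<in> F. e \<subseteq> f})"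
    by (intro sum_multicount_gen[symmetric]) auto
  also have "\<dots> \<le> (\<Sum>e\<in>?EA. 2)"
    by (intro sum_mono) (use two in auto)
  finally show ?thesis
    by simp
qed

text \<open>A pair in the link is the same as a face with exactly one vertex in \<open>A\<close>: the vertex is
  \<open>v\<close> and the remaining two vertices form \<open>e\<close>.\<close>

lemma sum_Lk:
  fixes E F :: "'v::finite set set" and g :: "'v set \<Rightarrow> real"
  assumes sc: "simplicial_complex2 E F"
  shows "(\<Sum>(e, v)\<in>Lk E F A. g e) = (\<Sum>f\<in>{f \<in> F. card (A \<inter> f) = 1}. g (f - A))"
proof (rule sum.reindex_bij_witness[where j = "\<lambda>(e, v). insert v e"
      and i = "\<lambda>f. (f - A, the_elem (A \<inter> f))"])
  fix ev assume ev: "ev \<in> Lk E F A"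
  then obtain e v where [simp]: "ev = (e, v)" and *: "e \<in> E" "e \<inter> A = {}" "v \<in> A" "insert v e \<in> F"
    by (auto simp: Lk_def)
  then have [simp]: "A \<inter> insert v e = {v}" "insert v e - A = e"
    by auto
  show "(case ev of (e, v) \<Rightarrow> insert v e) \<in> {f \<in> F. card (A \<inter> f) = 1}"
    using * by simp
  show "((case ev of (e, v) \<Rightarrow> insert v e) - A, the_elem (A \<inter> (case ev of (e, v) \<Rightarrow> insert v e))) = ev"
    by simp
  show "g ((case ev of (e, v) \<Rightarrow> insert v e) - A) = (case ev of (e, v) \<Rightarrow> g e)"
    by simp
next
  fix f assume f: "f \<in> {f \<in> F. card (A \<inter> f) = 1}"
  then obtain v where v: "A \<inter> f = {v}"
    by (auto simp: card_1_singleton_iff)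
  have ins: "insert v (f - A) = f"
    using v by auto
  have "card (f - A) = 2"
    using f sc v by (subst card_Diff_subset_Int) (auto simp: simplicial_complex2_def Int_commute)
  then have "f - A \<in> E"
    using f sc by (auto simp: simplicial_complex2_def)
  then show "(f - A, the_elem (A \<inter> f)) \<in> Lk E F A"
    using f v by (auto simp: Lk_def ins)
  show "(case (f - A, the_elem (A \<inter> f)) of (e, v) \<Rightarrow> insert v e) = f"
    by (simp add: v ins)
qed

lemma angle_sum_on_face:
  fixes E F :: "'v::finite set set"
  assumes sc: "simplicial_complex2 E F" and I: "\<forall>e\<in>E. 0 \<le> I e" and r: "\<forall>i. 0 < r$i"
    and f: "f \<in> F"
  shows "(\<Sum>i\<in>A \<inter> f. face_angle I r f i)
    \<le> (if card (A \<inter> f) \<ge> 2 then pi else 0) + (if card (A \<inter> f) = 1 then pi - Lam (I (f - A)) else 0)"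
proof -
  have cf: "card f = 3"
    using f sc by (auto simp: simplicial_complex2_def)
  have bounds: "face_angle I r f i + face_angle I r f j + face_angle I r f k \<le> pi"
    "0 \<le> face_angle I r f i" "face_angle I r f i \<le> pi - Lam (I {j, k})"
    if "f = {i, j, k}" "i \<noteq> j" "i \<noteq> k" "j \<noteq> k" for i j k
  proof -
    have "{i, j} \<in> E" "{i, k} \<in> E" "{j, k} \<in> E"
      using sc f that by (auto simp: simplicial_complex2_def)
    then show "face_angle I r f i + face_angle I r f j + face_angle I r f k \<le> pi"
      "0 \<le> face_angle I r f i" "face_angle I r f i \<le> pi - Lam (I {j, k})"
      using face_angle_bounds[of r i j k I] r I that by auto
  qed
  have nonneg: "0 \<le> face_angle I r f i" if "i \<in> f" for i
  proof -
    have "card (f - {i}) = 2"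
      using cf that by simp
    then obtain j k where "f - {i} = {j, k}" "j \<noteq> k"
      by (auto simp: card_2_iff)
    then show ?thesis
      using that by (intro bounds(2)[of i j k]) auto
  qed
  have total: "(\<Sum>i\<in>f. face_angle I r f i) \<le> pi"
  proof -
    obtain i j k where ijk: "f = {i, j, k}" "i \<noteq> j" "i \<noteq> k" "j \<noteq> k"
      using cf by (auto simp: card_3_iff)
    show ?thesis
      using bounds(1)[OF ijk] ijk by (subst ijk(1)) (simp add: add.assoc)
  qed
  consider "card (A \<inter> f) = 0" | "card (A \<inter> f) = 1" | "card (A \<inter> f) \<ge> 2"
    by linarith
  then show ?thesis
  proof cases
    case 1
    then show ?thesis by simp
  next
    case 2
    then obtain v where v: "A \<inter> f = {v}"
      by (auto simp: card_1_singleton_iff)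
    have "card (f - A) = 2"
      using cf v by (subst card_Diff_subset_Int) (auto simp: Int_commute)
    then obtain j k where jk: "f - A = {j, k}" "j \<noteq> k"
      by (auto simp: card_2_iff)
    have "f = {v, j, k}" "v \<noteq> j" "v \<noteq> k"
      using v jk by auto
    then have "face_angle I r f v \<le> pi - Lam (I {j, k})"
      using bounds(3) jk by blast
    then show ?thesis
      by (simp add: v jk(1))
  next
    case 3
    have "(\<Sum>i\<in>A \<inter> f. face_angle I r f i) \<le> (\<Sum>i\<in>f. face_angle I r f i)"
      using nonneg by (intro sum_mono2) auto
    then show ?thesis
      using total 3 by simp
  qed
qed

section \<open>The curvature bound\<close>

theorem theorem4p10:
  fixes M :: "'m topology"
    and E F :: "'v::finite set set"
    and I :: "'v set \<Rightarrow> real"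
  assumes "closed_surface M"
    and "triangulates E F M"
    and "\<forall>e\<in>E. 0 \<le> I e"
  shows "ext_curvature F I ` {r. \<forall>i. 0 < r$i}
           \<subseteq> (\<Inter>A\<in>{A. A \<noteq> {} \<and> A \<subset> UNIV}. closure (Y E F I A))"
proof (rule image_subsetI, rule INT_I)
  fix r :: "real^'v" and A :: "'v set"
  assume "r \<in> {r. \<forall>i. 0 < r$i}" and "A \<in> {A. A \<noteq> {} \<and> A \<subset> UNIV}"
  then have r: "\<forall>i. 0 < r$i" and A: "A \<noteq> {}"
    by auto
  have sc: "simplicial_complex2 E F"
    using assms(2) by (simp add: triangulates_def)
  let ?\<theta> = "face_angle I r" and ?EA = "{e \<in> E. e \<subseteq> A}" and ?FA = "{f \<in> F. f \<subseteq> A}"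
  let ?Lk = "\<Sum>(e, v)\<in>Lk E F A. pi - Lam (I e)"
  let ?n = "\<lambda>f. card (A \<inter> f)"

  have "(\<Sum>i\<in>A. \<Sum>f\<in>{f \<in> F. i \<in> f}. ?\<theta> f i) = (\<Sum>f\<in>F. \<Sum>i\<in>{i \<in> A. i \<in> f}. ?\<theta> f i)"
    by (rule sum.swap_restrict) auto
  also have "\<dots> = (\<Sum>f\<in>F. \<Sum>i\<in>A \<inter> f. ?\<theta> f i)"
    by (simp add: Int_def)
  also have "\<dots> \<le> (\<Sum>f\<in>F. (if ?n f \<ge> 2 then pi else 0) + (if ?n f = 1 then pi - Lam (I (f - A)) else 0))"
    using angle_sum_on_face[OF sc assms(3) r] by (rule sum_mono)
  also have "\<dots> = (\<Sum>f\<in>F. if ?n f \<ge> 2 then pi else 0)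
      + (\<Sum>f\<in>{f \<in> F. ?n f = 1}. pi - Lam (I (f - A)))"
    by (simp only: sum.distrib sum.inter_filter finite)
  also have "(\<Sum>f\<in>{f \<in> F. ?n f = 1}. pi - Lam (I (f - A))) = ?Lk"
    by (rule sum_Lk[OF sc, symmetric])
  finally have angles: "(\<Sum>i\<in>A. \<Sum>f\<in>{f \<in> F. i \<in> f}. ?\<theta> f i)
      \<le> (\<Sum>f\<in>F. if ?n f \<ge> 2 then pi else 0) + ?Lk" .

  \<comment> \<open>For \<open>n \<le> 3\<close> the number \<open>n choose 2\<close> is \<open>1\<close> for \<open>n \<ge> 2\<close> plus another \<open>2\<close> for \<open>n = 3\<close>, so
    the faces with at least two vertices in \<open>A\<close>, together with twice the faces inside \<open>A\<close>, count
    the incidences with edges inside \<open>A\<close>.\<close>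
  have "(\<Sum>f\<in>F. if ?n f \<ge> 2 then pi else 0) + 2 * pi * card ?FA
      = (\<Sum>f\<in>F. (if ?n f \<ge> 2 then pi else 0) + (if f \<subseteq> A then 2 * pi else 0))"
    by (simp add: sum.distrib sum.inter_filter[symmetric])
  also have "\<dots> = (\<Sum>f\<in>F. pi * real (?n f choose 2))"
  proof (rule sum.cong)
    fix f assume "f \<in> F"
    then have cf: "card f = 3"
      using sc by (auto simp: simplicial_complex2_def)
    have "?n f \<le> 3"
      using card_mono[of f "A \<inter> f"] cf by simp
    moreover have "f \<subseteq> A \<longleftrightarrow> ?n f = 3"
    proof
      assume "?n f = 3"
      then have "A \<inter> f = f"
        using cf by (intro card_subset_eq) auto
      then show "f \<subseteq> A" by blast
    qed (simp add: cf Int_absorb1)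
    moreover have "?n f = 0 \<or> ?n f = 1 \<or> ?n f = 2 \<or> ?n f = 3"
      using calculation(1) by linarith
    ultimately show "(if ?n f \<ge> 2 then pi else 0) + (if f \<subseteq> A then 2 * pi else 0)
        = pi * real (?n f choose 2)"
      by (elim disjE) (simp_all add: choose_two)
  qed simp
  also have "\<dots> = pi * real (\<Sum>f\<in>F. ?n f choose 2)"
    by (simp add: sum_distrib_left)
  also have "\<dots> \<le> pi * real (2 * card ?EA)"
  proof -
    have "card {f \<in> F. e \<subseteq> f} \<le> 2" if "e \<in> E" for e
      using edge_in_at_most_two_faces[OF assms(1,2)] sc that by (simp add: simplicial_complex2_def)
    then have "(\<Sum>f\<in>F. ?n f choose 2) \<le> 2 * card ?EA"
      by (rule sum_choose_two_le[OF sc])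
    then show ?thesis
      by (intro mult_left_mono of_nat_mono) auto
  qed
  finally have faces: "(\<Sum>f\<in>F. if ?n f \<ge> 2 then pi else 0) + 2 * pi * card ?FA \<le> 2 * pi * card ?EA"
    by simp

  have "(\<Sum>i\<in>A. ext_curvature F I r $ i) = 2 * pi * card A - (\<Sum>i\<in>A. \<Sum>f\<in>{f \<in> F. i \<in> f}. ?\<theta> f i)"
    by (simp add: ext_curvature_def sum_subtractf)
  also have "\<dots> \<ge> - ?Lk + 2 * pi * of_int (euler_char (subcomplex_on E F A))"
    using angles faces by (simp add: euler_char_subcomplex_on[OF sc] algebra_simps)
  finally show "ext_curvature F I r \<in> closure (Y E F I A)"
    using A by (intro in_closure_Y)
qed

end
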